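(* Let $r \geq 1$, let $H$ be a graph, let $S \subseteq V(H)$ be a vertex cover of $H$, and let $G = \mathrm{CCG}(H, S, r)$. Then the $r$-independence complex $\mathrm{Ind}_r(G)$ is shellable.
   Context: All graphs are finite and simple. A vertex cover of $H$ is a set $S\subseteq V(H)$ containing at least one endpoint of every edge. A star-clique graph $\mathrm{SC}(x)$ is a graph formed by attaching a collection of cliques $B_1,\dots,B_t$ (complete graphs, possibly of different sizes) to a central vertex $x$, i.e. each $B_i$ contains $x$ and the $B_i$ share no other vertices. $\mathrm{CCG}(H,S,r)$ is the graph obtained from $H$ by attaching to each vertex $x \in S$ a star-clique graph $\mathrm{SC}(x)$ with center $x$ and $|V(\mathrm{SC}(x))| \geq r+1$, whose vertices other than $x$ are new (not in $H$ and not in any other attached star-clique). For $r \geq 1$, a subset $A \subseteq V(G)$ is $r$-independent if every connected component of $G[A]$ has at most $r$ vertices; $\mathrm{Ind}_r(G)$ is the simplicial complex on $V(G)$ of all $r$-independent subsets. A (not necessarily pure) simplicial complex is shellable if its facets can be ordered $F_1,\dots,F_t$ so that for each $k>1$, $\langle F_k\rangle \cap \langle F_1,\dots,F_{k-1}\rangle$ is pure of dimension $\dim F_k-1$ ($\langle\mathcal F\rangle$ = complex generated by $\mathcal F$). *)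

theory Defs
  imports "Graph_Theory.Graph_Theory"
begin

section \<open>Graphs\<close>

text \<open>
  A finite simple graph is a \<^locale>\<open>pair_graph\<close>: a finite, loopless, symmetric digraph without
  parallel arcs, each edge being represented by its two orientations. As the arc relation is
  symmetric, the strongly connected components of such a graph (and of its induced subgraphs) are
  its connected components.
\<close>

definition vertex_cover :: "'a pair_pre_digraph \<Rightarrow> 'a set \<Rightarrow> bool" where
  "vertex_cover H S \<longleftrightarrow> S \<subseteq> pverts H \<and> (\<forall>(u, v) \<in> parcs H. u \<in> S \<or> v \<in> S)"

definition star_clique :: "'a \<Rightarrow> 'a pair_pre_digraph \<Rightarrow> bool" where
  "star_clique x C \<longleftrightarrow>
    (\<exists>Bs :: 'a pair_pre_digraph set. finite Bs \<and>
      (\<forall>B \<in> Bs. x \<in> pverts B \<and> complete_digraph (card (pverts B)) (with_proj B)) \<and>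
      pairwise (\<lambda>B B'. pverts B \<inter> pverts B' = {x}) Bs \<and>
      C = \<lparr> pverts = insert x (\<Union>B \<in> Bs. pverts B), parcs = (\<Union>B \<in> Bs. parcs B) \<rparr>)"

text \<open>
  The construction CCG(H, S, r) depends on the choice of the attached star-clique graphs, so it is
  a predicate on the resulting graph G rather than a function of H, S and r. The graph H is
  literally a subgraph of G, and \<open>SC x\<close> is the star-clique graph attached at x.
\<close>

definition is_CCG ::
  "'a pair_pre_digraph \<Rightarrow> 'a set \<Rightarrow> nat \<Rightarrow> 'a pair_pre_digraph \<Rightarrow> bool" where
  "is_CCG H S r G \<longleftrightarrow>
    (\<exists>SC :: 'a \<Rightarrow> 'a pair_pre_digraph.
      (\<forall>x \<in> S. star_clique x (SC x) \<and> card (pverts (SC x)) \<ge> r + 1 \<and>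
        (pverts (SC x) - {x}) \<inter> pverts H = {}) \<and>
      (\<forall>x \<in> S. \<forall>y \<in> S. x \<noteq> y \<longrightarrow> (pverts (SC x) - {x}) \<inter> (pverts (SC y) - {y}) = {}) \<and>
      G = \<lparr> pverts = pverts H \<union> (\<Union>x \<in> S. pverts (SC x)),
            parcs = parcs H \<union> (\<Union>x \<in> S. parcs (SC x)) \<rparr>)"

definition r_independent :: "nat \<Rightarrow> 'a pair_pre_digraph \<Rightarrow> 'a set \<Rightarrow> bool" where
  "r_independent r G A \<longleftrightarrow> A \<subseteq> pverts G \<and>
    (\<forall>C \<in> pre_digraph.sccs_verts (with_proj G \<restriction> A). card C \<le> r)"

definition Ind :: "nat \<Rightarrow> 'a pair_pre_digraph \<Rightarrow> 'a set set" where
  "Ind r G = {A. r_independent r G A}"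


section \<open>Simplicial complexes\<close>

text \<open>
  A simplicial complex is represented by its set of faces, the empty face included. The dimension
  of a face F is |F| - 1, hence -1 for the empty face.
\<close>

definition face_dim :: "'a set \<Rightarrow> int" where
  "face_dim F = int (card F) - 1"

definition facets :: "'a set set \<Rightarrow> 'a set set" where
  "facets K = {F \<in> K. \<forall>F' \<in> K. F \<subseteq> F' \<longrightarrow> F' = F}"

definition generated_complex :: "'a set set \<Rightarrow> 'a set set" where
  "generated_complex \<F> = {\<sigma>. \<exists>F \<in> \<F>. \<sigma> \<subseteq> F}"

definition pure_of_dim :: "'a set set \<Rightarrow> int \<Rightarrow> bool" where
  "pure_of_dim K d \<longleftrightarrow> K \<noteq> {} \<and> (\<forall>F \<in> facets K. face_dim F = d)"

definition shellable :: "'a set set \<Rightarrow> bool" where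
  "shellable K \<longleftrightarrow>
    (\<exists>Fs. distinct Fs \<and> set Fs = facets K \<and>
      (\<forall>k. 0 < k \<and> k < length Fs \<longrightarrow>
        pure_of_dim (generated_complex {Fs ! k} \<inter> generated_complex (set (take k Fs)))
          (face_dim (Fs ! k) - 1)))"


section \<open>Well-definedness\<close>

lemma pair_graphI:
  fixes G :: "'a pair_pre_digraph"
  assumes "finite (pverts G)"
    and "\<And>u v. (u, v) \<in> parcs G \<Longrightarrow> u \<in> pverts G \<and> v \<in> pverts G \<and> u \<noteq> v \<and> (v, u) \<in> parcs G"
  shows "pair_graph G"
proof -
  have sub: "parcs G \<subseteq> pverts G \<times> pverts G"
    using assms(2) by auto
  have fin: "finite (parcs G)"
    by (rule finite_subset[OF sub]) (simp add: assms(1))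
  have sym: "symmetric (with_proj G)"
    unfolding symmetric_def with_proj_simps by (rule symI) (use assms(2) in blast)
  show ?thesis
  proof (intro pair_graph.intro pair_digraph.intro pair_pseudo_graph.intro pair_fin_digraph.intro
      pair_loopfree_digraph.intro pair_sym_digraph.intro pair_wf_digraph.intro
      pair_fin_digraph_axioms.intro pair_loopfree_digraph_axioms.intro pair_sym_digraph_axioms.intro)
  qed (use assms fin sym in auto)
qed

lemma pair_graphD:
  fixes G :: "'a pair_pre_digraph"
  assumes "pair_graph G"
  shows "finite (pverts G)"
    and "(u, v) \<in> parcs G \<Longrightarrow> u \<in> pverts G \<and> v \<in> pverts G \<and> u \<noteq> v \<and> (v, u) \<in> parcs G"
proof -
  interpret pair_graph G by fact
  show "finite (pverts G)" by (rule pair_finite_verts)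
  show "u \<in> pverts G \<and> v \<in> pverts G \<and> u \<noteq> v \<and> (v, u) \<in> parcs G" if "(u, v) \<in> parcs G"
    using in_arcsD1[OF that] in_arcsD2[OF that] no_loops'[OF that] arcs_symmetric[OF that] by simp
qed

lemma star_clique_pair_graph:
  assumes "star_clique x C"
  shows "pair_graph C"
proof -
  obtain Bs where Bs: "finite Bs"
      "\<forall>B \<in> Bs. x \<in> pverts B \<and> complete_digraph (card (pverts B)) (with_proj B)"
    and C: "C = \<lparr> pverts = insert x (\<Union>B \<in> Bs. pverts B), parcs = (\<Union>B \<in> Bs. parcs B) \<rparr>"
    using assms unfolding star_clique_def by blast
  have g: "pair_graph B" if "B \<in> Bs" for B
    by (rule pair_graphI_graph) (use Bs(2) that in \<open>simp add: complete_digraph_def\<close>)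
  show ?thesis
  proof (rule pair_graphI)
    show "finite (pverts C)"
      using Bs(1) pair_graphD(1)[OF g] unfolding C by simp
  next
    fix u v assume "(u, v) \<in> parcs C"
    then obtain B where B: "B \<in> Bs" "(u, v) \<in> parcs B" by (auto simp: C)
    from pair_graphD(2)[OF g[OF B(1)] B(2)] B(1)
    show "u \<in> pverts C \<and> v \<in> pverts C \<and> u \<noteq> v \<and> (v, u) \<in> parcs C" by (auto simp: C)
  qed
qed

lemma is_CCG_pair_graph:
  assumes H: "pair_graph H" and S: "S \<subseteq> pverts H" and G: "is_CCG H S r G"
  shows "pair_graph G"
proof -
  obtain SC where SC: "\<forall>x \<in> S. star_clique x (SC x)"
    and G: "G = \<lparr> pverts = pverts H \<union> (\<Union>x \<in> S. pverts (SC x)),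
            parcs = parcs H \<union> (\<Union>x \<in> S. parcs (SC x)) \<rparr>"
    using G unfolding is_CCG_def by blast
  have g: "pair_graph (SC x)" if "x \<in> S" for x
    by (rule star_clique_pair_graph) (use SC that in blast)
  show ?thesis
  proof (rule pair_graphI)
    show "finite (pverts G)"
      using pair_graphD(1)[OF H] finite_subset[OF S pair_graphD(1)[OF H]] pair_graphD(1)[OF g]
      unfolding G by simp
  next
    fix u v assume "(u, v) \<in> parcs G"
    then consider "(u, v) \<in> parcs H" | x where "x \<in> S" "(u, v) \<in> parcs (SC x)" by (auto simp: G)
    then show "u \<in> pverts G \<and> v \<in> pverts G \<and> u \<noteq> v \<and> (v, u) \<in> parcs G"
    proof cases
      case 1
      from pair_graphD(2)[OF H this] show ?thesis by (auto simp: G)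
    next
      case 2
      from pair_graphD(2)[OF g[OF 2(1)] 2(2)] 2(1) show ?thesis by (auto simp: G)
    qed
  qed
qed

lemma Ind_subset_closed:
  assumes G: "pair_graph G" and A: "A \<in> Ind r G" and BA: "B \<subseteq> A"
  shows "B \<in> Ind r G"
proof -
  let ?GA = "with_proj G \<restriction> A" and ?GB = "with_proj G \<restriction> B"
  have Ac: "card C \<le> r" if "C \<in> pre_digraph.sccs_verts ?GA" for C
    using A that by (simp add: Ind_def r_independent_def)
  interpret G: pair_graph G by (rule G)
  interpret GA: wf_digraph ?GA by (rule G.wellformed_induce_subgraph)
  have AV: "A \<subseteq> pverts G"
    using A by (simp add: Ind_def r_independent_def)
  have fA: "finite A"
    using finite_subset[OF AV G.pair_finite_verts] .
  have mono: "u \<rightarrow>\<^sup>*\<^bsub>?GA\<^esub> v" if "u \<rightarrow>\<^sup>*\<^bsub>?GB\<^esub> v" for u v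
    unfolding reachable_def
    by (rule rtrancl_on_mono[OF _ _ that[unfolded reachable_def]]) (use BA in \<open>auto simp: arcs_ends_conv\<close>)
  have "card C \<le> r" if C: "C \<in> pre_digraph.sccs_verts ?GB" for C
  proof -
    obtain u where u: "u \<in> C"
      using C unfolding pre_digraph.sccs_verts_def by blast
    let ?D = "pre_digraph.scc_of ?GA u"
    have CD: "C \<subseteq> ?D"
    proof
      fix v assume "v \<in> C"
      with C u have "u \<rightarrow>\<^sup>*\<^bsub>?GB\<^esub> v" "v \<rightarrow>\<^sup>*\<^bsub>?GB\<^esub> u"
        unfolding pre_digraph.sccs_verts_def by blast+
      from mono[OF this(1)] mono[OF this(2)] show "v \<in> ?D"
        unfolding pre_digraph.scc_of_def by simp
    qed
    have "?D \<in> pre_digraph.sccs_verts ?GA"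
    proof -
      have "u \<in> ?D" using CD u by blast
      then show ?thesis
        unfolding pre_digraph.sccs_verts_def pre_digraph.scc_of_def
        by (blast intro: GA.reachable_trans)
    qed
    moreover have "?D \<subseteq> A"
    proof
      fix v assume "v \<in> ?D"
      then have "u \<rightarrow>\<^sup>*\<^bsub>?GA\<^esub> v" unfolding pre_digraph.scc_of_def by simp
      then have "v \<in> verts ?GA" by (rule GA.reachable_in_verts(2))
      then show "v \<in> A" by simp
    qed
    ultimately show ?thesis
      using le_trans[OF card_mono[OF finite_subset[OF _ fA] CD] Ac] by blast
  qed
  then show ?thesis
    using subset_trans[OF BA AV] by (simp add: Ind_def r_independent_def)
qed

end

theory Submission
  imports Defs "HOL-Library.Nat_Bijection"
begin

text \<open>
  Write W for the vertices of H outside S and P for the attached vertices. Every vertex of P is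
  simplicial, every vertex of S has at least r neighbours in P, and W is independent with all its
  neighbours in S. List the facets lexicographically, S being more significant than W and W more
  than P, and sets without a vertex preceding sets with it. Let v be the first vertex at which an
  earlier facet F differs from F'. For v in S or W, the set F' - {v} can be filled up with vertices
  of P until every block that could accommodate v again is full, so that v stays out. For v in P,
  the sets with a prescribed trace on H form a direct sum of uniform matroids, and v can be
  exchanged for a vertex of F.
\<close>

section \<open>Lexicographic shellings\<close>

text \<open>Binary comparison: the elements of \<open>A\<close> below \<open>m\<close> contribute
  less than \<open>2 ^ m\<close> altogether, and every larger element of \<open>A\<close> is also
  counted in \<open>B\<close>.\<close>

lemma set_encode_lessI:
  assumes fin: "finite A" "finite B" and m: "m \<in> B" "m \<notin> A"
    and above: "\<And>n. n > m \<Longrightarrow> n \<in> A \<Longrightarrow> n \<in> B"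
  shows "set_encode A < set_encode B"
proof -
  let ?H = "A \<inter> {m<..}"
  have "set_encode A = set_encode ?H + set_encode (A \<inter> {..<m})"
  proof -
    have "A = ?H \<union> (A \<inter> {..<m})" using m(2) by (auto simp: not_less_iff_gr_or_eq)
    then have "set_encode A = set_encode (?H \<union> (A \<inter> {..<m}))" by simp
    also have "\<dots> = set_encode ?H + set_encode (A \<inter> {..<m})"
      unfolding set_encode_def by (rule sum.union_disjoint) (use fin in auto)
    finally show ?thesis .
  qed
  also have "set_encode (A \<inter> {..<m}) \<le> set_encode {..<m}"
    unfolding set_encode_def by (rule sum_mono2) auto
  also have "set_encode {..<m} < 2 ^ m"
    unfolding set_encode_def using sum_power2[of m] by (simp add: lessThan_atLeast0)
  also have "set_encode ?H + 2 ^ m = set_encode (insert m ?H)"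
    using fin by simp
  also have "\<dots> \<le> set_encode B"
    unfolding set_encode_def by (rule sum_mono2) (use fin m above in auto)
  finally show ?thesis by simp
qed

text \<open>\<open>m\<close> is the largest element of the symmetric difference; were it in
  \<open>A\<close>, \<open>set_encode_lessI\<close> would reverse the inequality.\<close>

lemma set_encode_lessD:
  assumes fin: "finite A" "finite B" and less: "set_encode A < set_encode B"
  obtains m where "m \<in> B" "m \<notin> A" "\<And>n. n > m \<Longrightarrow> n \<in> A \<longleftrightarrow> n \<in> B"
proof -
  let ?D = "(A - B) \<union> (B - A)"
  define m where "m = Max ?D"
  have finD: "finite ?D" using fin by simp
  have "?D \<noteq> {}" using less by auto
  then have mD: "m \<in> ?D" unfolding m_def by (rule Max_in[OF finD])
  have eq: "n \<in> A \<longleftrightarrow> n \<in> B" if "n > m" for n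
    using Max_ge[OF finD, of n] that unfolding m_def[symmetric] by auto
  have "m \<notin> A"
  proof
    assume "m \<in> A"
    with mD have "m \<notin> B" by blast
    from set_encode_lessI[OF fin(2,1) \<open>m \<in> A\<close> this] eq have "set_encode B < set_encode A" by blast
    with less show False by simp
  qed
  with mD eq that show thesis by blast
qed

text \<open>Facets are sorted by the binary code of their image under \<open>f\<close>. A maximal
  face of the intersection lies in some earlier \<open>F\<close>, hence misses the vertex
  \<open>v\<close> of \<open>F'\<close> at which the two codes first differ. The exchange yields a
  facet \<open>F''\<close> of smaller code, so \<open>F' - {v}\<close> lies in the intersection and
  equals that face.\<close>

lemma shellable_lexicographic:
  fixes K :: "'a set set" and f :: "'a \<Rightarrow> nat"
  assumes fin: "finite V" and sub: "\<And>F. F \<in> facets K \<Longrightarrow> F \<subseteq> V" and inj: "inj_on f V"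
    and exch: "\<And>F F' v. F \<in> facets K \<Longrightarrow> F' \<in> facets K \<Longrightarrow> v \<in> F' \<Longrightarrow> v \<notin> F \<Longrightarrow>
      (\<And>u. u \<in> V \<Longrightarrow> f u > f v \<Longrightarrow> u \<in> F \<longleftrightarrow> u \<in> F') \<Longrightarrow>
      \<exists>F'' \<in> facets K. F' - {v} \<subseteq> F'' \<and> v \<notin> F'' \<and> (\<forall>u \<in> F'' - F'. f u < f v)"
  shows "shellable K"
proof -
  define key where "key F = set_encode (f ` F)" for F
  have finF: "finite F" if "F \<in> facets K" for F
    using finite_subset[OF sub[OF that] fin] .
  have mem: "f u \<in> f ` F \<longleftrightarrow> u \<in> F" if "F \<in> facets K" "u \<in> V" for F u
    using inj_on_image_mem_iff[OF inj that(2) sub[OF that(1)]] .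
  have keyinj: "inj_on key (facets K)"
  proof (rule inj_onI)
    fix F F' assume F: "F \<in> facets K" "F' \<in> facets K" "key F = key F'"
    then have "f ` F = f ` F'"
      unfolding key_def using set_encode_eq[of "f ` F" "f ` F'"] finF by simp
    then show "F = F'"
      using inj_on_image_eq_iff[OF inj sub[OF F(1)] sub[OF F(2)]] by simp
  qed
  have "facets K \<subseteq> Pow V" using sub by blast
  then have "finite (facets K)" using fin by (simp add: finite_subset)
  then obtain xs where xs: "set xs = facets K" "distinct xs"
    using finite_distinct_list by blast
  define Fs where "Fs = sort_key key xs"
  have set: "set Fs = facets K" and dist: "distinct Fs" and sorted: "sorted (map key Fs)"
    using xs by (simp_all add: Fs_def)
  have mono: "key (Fs ! i) \<le> key (Fs ! j)" if "i \<le> j" "j < length Fs" for i j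
    using sorted_nth_mono[OF sorted that(1)] that by simp
  have less: "key (Fs ! i) < key (Fs ! k)" if "i < k" "k < length Fs" for i k
  proof -
    have "Fs ! i \<noteq> Fs ! k" using dist that by (simp add: nth_eq_iff_index_eq)
    then have "key (Fs ! i) \<noteq> key (Fs ! k)"
      using keyinj that set by (metis inj_onD nth_mem order.strict_trans)
    with mono[of i k] that show ?thesis by simp
  qed
  have "pure_of_dim (generated_complex {Fs ! k} \<inter> generated_complex (set (take k Fs)))
      (face_dim (Fs ! k) - 1)"
    if k: "0 < k" "k < length Fs" for k
  proof -
    let ?I = "generated_complex {Fs ! k} \<inter> generated_complex (set (take k Fs))"
    let ?F' = "Fs ! k"
    have F': "?F' \<in> facets K" using k set by force
    \<comment> \<open>\<open>pure_of_dim\<close> demands a nonempty complex; the empty face serves,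
      being contained in the first facet.\<close>
    have "Fs ! 0 \<in> set (take k Fs)"
      using k by (auto simp: in_set_conv_nth intro!: exI[of _ 0])
    then have ne: "{} \<in> ?I"
      unfolding generated_complex_def by auto
    have "face_dim \<sigma> = face_dim ?F' - 1" if \<sigma>: "\<sigma> \<in> facets ?I" for \<sigma>
    proof -
      from \<sigma> have \<sigma>I: "\<sigma> \<in> ?I" and max: "\<And>\<tau>. \<tau> \<in> ?I \<Longrightarrow> \<sigma> \<subseteq> \<tau> \<Longrightarrow> \<tau> = \<sigma>"
        unfolding facets_def by auto
      from \<sigma>I obtain i where i: "i < k" "\<sigma> \<subseteq> Fs ! i" and \<sigma>F': "\<sigma> \<subseteq> ?F'"
        unfolding generated_complex_def by (auto simp: in_set_conv_nth)
      let ?F = "Fs ! i"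
      have F: "?F \<in> facets K" using i k set by force
      from less[OF i(1) k(2)] have "set_encode (f ` ?F) < set_encode (f ` ?F')"
        by (simp add: key_def)
      then obtain m where m: "m \<in> f ` ?F'" "m \<notin> f ` ?F"
        and eq: "\<And>n. n > m \<Longrightarrow> n \<in> f ` ?F \<longleftrightarrow> n \<in> f ` ?F'"
        using set_encode_lessD[of "f ` ?F" "f ` ?F'"] finF[OF F] finF[OF F'] by blast
      from m obtain v where v: "v \<in> ?F'" "v \<notin> ?F" "m = f v" by blast
      have "u \<in> ?F \<longleftrightarrow> u \<in> ?F'" if "u \<in> V" "f u > f v" for u
        using eq[of "f u"] that mem[OF F] mem[OF F'] v(3) by blast
      from exch[OF F F' v(1,2) this] obtain F'' where F'': "F'' \<in> facets K" "?F' - {v} \<subseteq> F''" "v \<notin> F''"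
        and lower: "\<And>u. u \<in> F'' - ?F' \<Longrightarrow> f u < f v" by blast
      \<comment> \<open>\<open>F''\<close> loses \<open>v\<close> and gains only lighter vertices,
        so \<open>f v\<close> is the top bit at which the codes differ.\<close>
      have "key F'' < key ?F'"
        unfolding key_def
      proof (rule set_encode_lessI)
        show "f v \<in> f ` ?F'" using v by blast
        show "f v \<notin> f ` F''" using mem[OF F''(1)] F''(3) v(1) sub[OF F'] by blast
        show "n \<in> f ` ?F'" if "n > f v" "n \<in> f ` F''" for n
          using that lower by (metis DiffI imageE image_eqI order_less_asym)
      qed (use finF F' F''(1) in auto)
      moreover obtain j where j: "j < length Fs" "F'' = Fs ! j"
        using F''(1) set by (metis in_set_conv_nth)
      ultimately have "j < k" using mono[of k j] by (meson not_le)
      then have "F'' \<in> set (take k Fs)"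
        using j by (auto simp: in_set_conv_nth)
      then have "?F' - {v} \<in> ?I"
        using F''(2) unfolding generated_complex_def by auto
      moreover have "\<sigma> \<subseteq> ?F' - {v}" using \<sigma>F' i v by blast
      ultimately have "\<sigma> = ?F' - {v}" using max by blast
      moreover have "card ?F' > 0" using v(1) finF[OF F'] by (auto simp: card_gt_0_iff)
      ultimately show ?thesis
        using v(1) by (simp add: face_dim_def card_Diff_singleton of_nat_diff)
    qed
    with ne show ?thesis unfolding pure_of_dim_def by blast
  qed
  with set dist show ?thesis unfolding shellable_def by blast
qed


section \<open>Components of induced subgraphs\<close>

text \<open>For \<open>u\<close> outside \<open>A\<close> reflexivity still gives
  \<open>{u}\<close>, so bounds on components can be stated for every \<open>u\<close>.\<close>

definition component :: "('a \<times> 'a) set \<Rightarrow> 'a set \<Rightarrow> 'a \<Rightarrow> 'a set" where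
  "component E A u = (E \<inter> A \<times> A)\<^sup>* `` {u}"

definition simplicial :: "('a \<times> 'a) set \<Rightarrow> 'a \<Rightarrow> bool" where
  "simplicial E p \<longleftrightarrow> (\<forall>a b. (p, a) \<in> E \<longrightarrow> (p, b) \<in> E \<longrightarrow> a \<noteq> b \<longrightarrow> (a, b) \<in> E)"

lemma component_self: "u \<in> component E A u"
  by (simp add: component_def)

lemma component_subset: "u \<in> A \<Longrightarrow> component E A u \<subseteq> A"
  by (auto simp: component_def elim: rtranclE)

lemma component_outside:
  assumes "u \<notin> A" shows "component E A u = {u}"
  using assms by (auto simp: component_def elim: converse_rtranclE)

lemma component_mono:
  assumes "A \<subseteq> B" shows "component E A u \<subseteq> component E B u"
proof -
  have "(E \<inter> A \<times> A)\<^sup>* \<subseteq> (E \<inter> B \<times> B)\<^sup>*"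
    by (rule rtrancl_mono) (use assms in blast)
  then show ?thesis unfolding component_def by blast
qed

lemma component_edge:
  "\<lbrakk>(u, v) \<in> E; u \<in> A; v \<in> A\<rbrakk> \<Longrightarrow> v \<in> component E A u"
  by (auto simp: component_def)

lemma component_eq:
  assumes "sym E" "v \<in> component E A u"
  shows "component E A v = component E A u"
proof -
  have "sym ((E \<inter> A \<times> A)\<^sup>*)"
    by (rule sym_rtrancl) (use assms(1) in \<open>auto simp: sym_def\<close>)
  then have "(v, u) \<in> (E \<inter> A \<times> A)\<^sup>*" "(u, v) \<in> (E \<inter> A \<times> A)\<^sup>*"
    using assms(2) by (auto simp: component_def dest: symD)
  then show ?thesis
    unfolding component_def by (auto intro: rtrancl_trans)
qed

text \<open>A path can bypass a simplicial vertex, so deleting such vertices does not disconnect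
  anything.\<close>
lemma component_Int_simplicial:
  assumes "sym E" and AM: "A \<subseteq> M" and simp: "\<And>p. p \<in> M - A \<Longrightarrow> simplicial E p" and u: "u \<in> A"
  shows "component E A u = component E M u \<inter> A"
proof
  show "component E A u \<subseteq> component E M u \<inter> A"
    using component_mono[OF AM] component_subset[OF u] by blast
next
  let ?R = "(E \<inter> A \<times> A)\<^sup>*"
  have ext: "(u, b) \<in> ?R" if "(u, a) \<in> ?R" "(a, b) \<in> E" "a \<in> A" "b \<in> A" for a b
    using that by (auto intro: rtrancl_into_rtrancl)
  \<comment> \<open>Walk invariant: a vertex of \<open>A\<close> on the walk is reachable inside
    \<open>A\<close>; at a vertex \<open>z\<close> outside \<open>A\<close>, all neighbours of
    \<open>z\<close> in \<open>A\<close> are. The second half lets the walk bypass several deleted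
    vertices in a row.\<close>
  have "(z \<in> A \<longrightarrow> (u, z) \<in> ?R) \<and> (z \<notin> A \<longrightarrow> (\<forall>y \<in> A. (z, y) \<in> E \<longrightarrow> (u, y) \<in> ?R))"
    if "(u, z) \<in> (E \<inter> M \<times> M)\<^sup>*" for z
    using that
  proof (induction rule: rtrancl_induct)
    case base
    then show ?case using u by simp
  next
    case (step z z')
    have zz: "(z, z') \<in> E" "(z', z) \<in> E" "z' \<in> M" using step.hyps \<open>sym E\<close> by (auto dest: symD)
    show ?case
    proof (cases "z' \<in> A")
      case True
      then show ?thesis using zz step.IH ext by blast
    next
      case False
      then have "simplicial E z'" using simp zz by blast
      then have "y = z \<or> (z, y) \<in> E" if "(z', y) \<in> E" for y
        using that zz unfolding simplicial_def by blast
      then show ?thesis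
        using False step.IH ext by blast
    qed
  qed
  then show "component E M u \<inter> A \<subseteq> component E A u"
    unfolding component_def by blast
qed


section \<open>Shedding a cover by vertices with many simplicial neighbours\<close>

text \<open>\<open>P\<close> stands for the attached vertices. \<open>many\<close> records the size
  of the star-cliques without their centres, and \<open>W_nbr\<close> combines the vertex cover
  property with the fact that nothing is attached to \<open>W\<close>.\<close>

locale simplicial_cover =
  fixes r :: nat and E :: "('a \<times> 'a) set" and S W P :: "'a set"
  assumes r: "r \<ge> 1"
    and finite_S: "finite S" and finite_W: "finite W" and finite_P: "finite P"
    and disj: "S \<inter> W = {}" "S \<inter> P = {}" "W \<inter> P = {}"
    and sym: "sym E"
    and simplicial: "p \<in> P \<Longrightarrow> simplicial E p"
    and many: "x \<in> S \<Longrightarrow> r \<le> card {p \<in> P. (x, p) \<in> E}"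
    and W_nbr: "w \<in> W \<Longrightarrow> (w, y) \<in> E \<Longrightarrow> y \<in> S"
begin

section \<open>The complex of \<open>r\<close>-independent sets and its blocks\<close>

definition V where "V = S \<union> W \<union> P"

definition ok where "ok A \<longleftrightarrow> A \<subseteq> V \<and> (\<forall>u \<in> A. card (component E A u) \<le> r)"

text \<open>\<open>M A\<close> forgets the part of A inside P; its components are the blocks on which the condition
  \<open>ok\<close> becomes a uniform matroid on P.\<close>
definition M where "M A = A \<union> P"

text \<open>Only vertices of \<open>P\<close> are tested, so the trace on \<open>S\<close> and
  \<open>W\<close> stays fixed: \<open>A\<close> is a basis of the matroid belonging to that
  trace.\<close>

definition P_maximal where
  "P_maximal A \<longleftrightarrow> ok A \<and> (\<forall>p \<in> P - A. \<not> ok (insert p A))"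

lemma finite_V: "finite V"
  unfolding V_def using finite_S finite_W finite_P by simp

lemma ok_finite: "ok A \<Longrightarrow> finite A"
  unfolding ok_def using finite_subset[OF _ finite_V] by blast

lemma finite_component: "u \<in> A \<Longrightarrow> A \<subseteq> V \<Longrightarrow> finite (component E A u)"
  using component_subset finite_subset finite_V by meson

text \<open>By \<open>component_Int_simplicial\<close> the components of \<open>A\<close> are traces
  on \<open>A\<close> of components of \<open>M A\<close>. The latter depend only on
  \<open>A - P\<close>, so for a fixed trace the condition merely counts chosen vertices in each
  block.\<close>

lemma ok_iff: "ok A \<longleftrightarrow> A \<subseteq> V \<and> (\<forall>u. card (component E (M A) u \<inter> A) \<le> r)"
proof -
  have eq: "component E A u = component E (M A) u \<inter> A" if "u \<in> A" for u
    by (rule component_Int_simplicial[OF sym _ _ that]) (auto simp: M_def simplicial)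
  have "card (component E (M A) u \<inter> A) \<le> r" if A: "\<forall>u \<in> A. card (component E A u) \<le> r" for u
  proof (cases "component E (M A) u \<inter> A = {}")
    case False
    then obtain v where v: "v \<in> component E (M A) u" "v \<in> A" by blast
    then have "component E (M A) u \<inter> A = component E A v"
      using eq[OF v(2)] component_eq[OF sym v(1)] by simp
    with A v show ?thesis by simp
  qed simp
  then show ?thesis unfolding ok_def using eq by auto
qed

lemma ok_subset:
  assumes "ok A" "B \<subseteq> A" shows "ok B"
  unfolding ok_def
proof (intro conjI ballI)
  show "B \<subseteq> V" using assms unfolding ok_def by blast
  fix u assume u: "u \<in> B"
  have "card (component E B u) \<le> card (component E A u)"
    by (rule card_mono[OF finite_component component_mono]) (use assms u in \<open>auto simp: ok_def\<close>)
  also have "\<dots> \<le> r" using assms u unfolding ok_def by blast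
  finally show "card (component E B u) \<le> r" .
qed

section \<open>Saturation by vertices of \<open>P\<close>\<close>

text \<open>Adding \<open>p\<close> leaves the blocks unchanged and raises only the count of its own
  block, by at most one. As the result fails \<open>ok\<close>, that block was full.\<close>

lemma P_maximal_block:
  assumes A: "P_maximal A" and p: "p \<in> P" "p \<notin> A"
  shows "card (component E (M A) p \<inter> A) = r"
proof -
  have ok: "ok A" and nok: "\<not> ok (insert p A)" using A p unfolding P_maximal_def by auto
  have M: "M (insert p A) = M A" using p(1) by (auto simp: M_def)
  have "insert p A \<subseteq> V" using ok p unfolding ok_def V_def by blast
  with nok obtain u where u: "card (component E (M A) u \<inter> insert p A) > r"
    unfolding ok_iff M by (auto simp: not_le)
  have le: "card (component E (M A) u \<inter> A) \<le> r" for u using ok unfolding ok_iff by blast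
  have "p \<in> component E (M A) u"
  proof (rule ccontr)
    assume "p \<notin> component E (M A) u"
    then have "component E (M A) u \<inter> insert p A = component E (M A) u \<inter> A" by blast
    with u le[of u] show False by simp
  qed
  then have "component E (M A) u = component E (M A) p" using component_eq[OF sym] by metis
  moreover have "card (component E (M A) p \<inter> insert p A) \<le> Suc (card (component E (M A) p \<inter> A))"
    using p ok_finite[OF ok] component_self[of p E "M A"]
    by (simp add: Int_insert_right)
  ultimately show ?thesis using u le[of p] by simp
qed

lemma P_maximal_extension:
  assumes "ok A"
  obtains B where "P_maximal B" "A \<subseteq> B" "B \<subseteq> A \<union> P"
proof -
  let ?C = "{B. ok B \<and> A \<subseteq> B \<and> B \<subseteq> A \<union> P}"
  have "finite ?C" by (rule finite_subset[of _ "Pow V"]) (use finite_V in \<open>auto simp: ok_def\<close>)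
  moreover have "A \<in> ?C" using assms by simp
  ultimately obtain B where B: "B \<in> ?C" and max: "\<forall>B' \<in> ?C. B \<subseteq> B' \<longrightarrow> B = B'"
    using finite_has_maximal[of ?C] by (metis (no_types, lifting) empty_iff)
  have "\<not> ok (insert p B)" if p: "p \<in> P - B" for p
  proof
    assume "ok (insert p B)"
    with B p have "insert p B \<in> ?C" by auto
    with max have "B = insert p B" by blast
    with p show False by blast
  qed
  with B have "P_maximal B" unfolding P_maximal_def by simp
  with B that show thesis by simp
qed

text \<open>The enlarged block contains x and its neighbours in P, which are too many to be chosen all,
  and the block of a missing neighbour already holds r chosen vertices.\<close>
lemma P_maximal_blocked:
  assumes A: "P_maximal A" and y: "y \<notin> A" and x: "x \<in> S" "x = y \<or> x \<in> A \<and> (y, x) \<in> E"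
  shows "\<not> ok (insert y A)"
proof
  assume ok: "ok (insert y A)"
  let ?N = "{p \<in> P. (x, p) \<in> E}" and ?K = "component E (M (insert y A)) y"
  have xK: "x \<in> ?K"
    using x(2) component_self component_edge[of y x E "M (insert y A)"] by (auto simp: M_def)
  have Kx: "component E (M (insert y A)) x = ?K" by (rule component_eq[OF sym xK])
  have N: "insert x ?N \<subseteq> ?K"
    using xK component_edge[of x _ E "M (insert y A)"] x(2) unfolding Kx by (auto simp: M_def)
  have le: "card (?K \<inter> insert y A) \<le> r" using ok unfolding ok_iff by blast
  have fin: "finite (insert y A)" using ok_finite[OF ok] .
  have "x \<notin> P" using x disj by blast
  then have cN: "card (insert x ?N) > r" using many[OF x(1)] finite_P by simp
  obtain p where p: "p \<in> ?N" "p \<notin> A"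
  proof (rule ccontr)
    assume "\<not> thesis"
    with that have "insert x ?N \<subseteq> ?K \<inter> insert y A" using N x(2) by blast
    then have "card (insert x ?N) \<le> card (?K \<inter> insert y A)"
      by (rule card_mono[rotated]) (use fin in simp)
    with cN le show False by simp
  qed
  have "card (component E (M A) p \<inter> A) = r" using P_maximal_block[OF A] p by blast
  \<comment> \<open>\<open>y\<close> lies outside \<open>A\<close>, so the enlarged block would hold
    \<open>r + 1\<close> chosen vertices.\<close>
  moreover have "insert y (component E (M A) p \<inter> A) \<subseteq> ?K \<inter> insert y A"
  proof -
    have "component E (M A) p \<subseteq> component E (M (insert y A)) p"
      by (rule component_mono) (auto simp: M_def)
    also have "\<dots> = ?K" by (rule component_eq[OF sym]) (use N p in blast)
    finally show ?thesis using component_self by fast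
  qed
  then have "card (insert y (component E (M A) p \<inter> A)) \<le> card (?K \<inter> insert y A)"
    by (rule card_mono[rotated]) (use fin in simp)
  ultimately show False using le y fin by simp
qed

text \<open>By \<open>P_maximal_blocked\<close>, a \<open>P_maximal\<close> set rejects every
  missing vertex of \<open>S\<close> and every missing vertex of \<open>W\<close> with a neighbour
  in \<open>F \<inter> S\<close>. A vertex of \<open>W\<close> without such a neighbour would be
  isolated and, since \<open>r \<ge> 1\<close>, could be added.\<close>

lemma facets_ok_iff:
  "F \<in> facets {A. ok A} \<longleftrightarrow> P_maximal F \<and> (\<forall>w \<in> W - F. \<exists>x \<in> F \<inter> S. (w, x) \<in> E)"
proof
  assume F: "F \<in> facets {A. ok A}"
  then have ok: "ok F" and max: "\<And>B. ok B \<Longrightarrow> F \<subseteq> B \<Longrightarrow> B = F" unfolding facets_def by auto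
  have nok: "\<not> ok (insert y F)" if "y \<notin> F" for y using max[of "insert y F"] that by blast
  have "\<exists>x \<in> F \<inter> S. (w, x) \<in> E" if w: "w \<in> W - F" for w
  proof (rule ccontr)
    assume "\<not> ?thesis"
    then have iso: "(w, y) \<notin> E" if "y \<in> F" for y using W_nbr w that by blast
    let ?F = "insert w F"
    \<comment> \<open>A loop at \<open>w\<close> would put \<open>w\<close> into \<open>S\<close> by
      \<open>W_nbr\<close>, so adding \<open>w\<close> brings no edge at all.\<close>
    have R: "E \<inter> ?F \<times> ?F = E \<inter> F \<times> F"
      using iso W_nbr[of w w] w disj symD[OF sym] by blast
    have "component E ?F u = component E F u" for u unfolding component_def R ..
    moreover have "component E F w = {w}" using component_outside w by fast
    ultimately have "ok ?F" using ok w r unfolding ok_def V_def by auto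
    with nok w show False by blast
  qed
  with ok nok show "P_maximal F \<and> (\<forall>w \<in> W - F. \<exists>x \<in> F \<inter> S. (w, x) \<in> E)"
    unfolding P_maximal_def by blast
next
  assume F: "P_maximal F \<and> (\<forall>w \<in> W - F. \<exists>x \<in> F \<inter> S. (w, x) \<in> E)"
  have nok: "\<not> ok (insert y F)" if y: "y \<in> V - F" for y
  proof -
    consider "y \<in> S" | "y \<in> W" | "y \<in> P" using y unfolding V_def by blast
    then show ?thesis
    proof cases
      case 1 then show ?thesis using P_maximal_blocked[of F y y] F y by blast
    next
      case 2 then show ?thesis using P_maximal_blocked[of F y] F y by blast
    next
      case 3 then show ?thesis using F y unfolding P_maximal_def by blast
    qed
  qed
  have "B = F" if "ok B" "F \<subseteq> B" for B
  proof (rule ccontr)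
    assume "B \<noteq> F"
    with that obtain y where y: "y \<in> B" "y \<notin> F" by blast
    then have "ok (insert y F)" using ok_subset[OF that(1)] that(2) by blast
    moreover have "y \<in> V" using y that unfolding ok_def by blast
    ultimately show False using nok y by blast
  qed
  with F show "F \<in> facets {A. ok A}" unfolding facets_def P_maximal_def by blast
qed

section \<open>Exchange properties of facets\<close>

text \<open>Basis exchange: equal traces give \<open>F\<close> and \<open>F'\<close> the same
  blocks. The block of \<open>v\<close> holds \<open>r\<close> vertices of \<open>F\<close> but
  fewer than \<open>r\<close> of \<open>F' - {v}\<close>, which supplies \<open>u\<close>; swapping
  inside one block keeps all counts.\<close>

lemma facet_exchange_P:
  assumes F: "F \<in> facets {A. ok A}" and F': "F' \<in> facets {A. ok A}"
    and v: "v \<in> P" "v \<in> F'" "v \<notin> F" and agree: "F - P = F' - P"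
  obtains u where "u \<in> F" "u \<notin> F'" "u \<in> P" "insert u (F' - {v}) \<in> facets {A. ok A}"
proof -
  have PF: "P_maximal F" and PF': "P_maximal F'"
    and domF': "\<forall>w \<in> W - F'. \<exists>x \<in> F' \<inter> S. (w, x) \<in> E"
    using F F' facets_ok_iff by auto
  have ok: "ok F" "ok F'" using PF PF' unfolding P_maximal_def by auto
  have fin: "finite F" "finite F'" using ok ok_finite by auto
  have MM: "M F = M F'" using agree by (auto simp: M_def)
  let ?K = "component E (M F') v"
  have "card (?K \<inter> F) = r" using P_maximal_block[OF PF v(1,3)] MM by simp
  moreover have "card (?K \<inter> F') \<le> r" using ok(2) unfolding ok_iff by blast
  moreover have "card (?K \<inter> (F' - {v})) < card (?K \<inter> F')"
    by (rule psubset_card_mono) (use fin v component_self[of v E "M F'"] in auto)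
  ultimately have "\<not> ?K \<inter> F \<subseteq> ?K \<inter> (F' - {v})"
    using card_mono[of "?K \<inter> (F' - {v})" "?K \<inter> F"] fin by auto
  then obtain u where u: "u \<in> ?K" "u \<in> F" "u \<notin> F'" using v(3) by blast
  have uP: "u \<in> P" using u agree by blast
  let ?F = "insert u (F' - {v})"
  have M: "M ?F = M F'" using uP v(1) by (auto simp: M_def)
  have uv: "u \<in> component E (M F') z \<longleftrightarrow> v \<in> component E (M F') z" for z
    using component_eq[OF sym] u(1) component_self by metis
  have card: "card (component E (M F') z \<inter> ?F) = card (component E (M F') z \<inter> F')" for z
  proof (cases "u \<in> component E (M F') z")
    case True
    let ?L = "component E (M F') z"
    have "?L \<inter> ?F = insert u (?L \<inter> F' - {v})" using True by blast
    then have "card (?L \<inter> ?F) = Suc (card (?L \<inter> F' - {v}))" using u fin by simp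
    moreover have "v \<in> ?L \<inter> F'" using True uv v by blast
    then have "Suc (card (?L \<inter> F' - {v})) = card (?L \<inter> F')" 
      by (intro card_Suc_Diff1) (use fin in simp)
    ultimately show ?thesis by simp
  next
    case False
    then have "component E (M F') z \<inter> ?F = component E (M F') z \<inter> F'" using uv[of z] by auto
    then show ?thesis by simp
  qed
  have "?F \<subseteq> V" using ok u unfolding ok_def by blast
  with ok(2) have "ok ?F" unfolding ok_iff M card by blast
  moreover have "\<not> ok (insert p ?F)" if p: "p \<in> P - ?F" for p
  proof -
    \<comment> \<open>If \<open>p = v\<close>, its block is that of \<open>u\<close>, full because
      \<open>u\<close> was missing from \<open>F'\<close>; any other missing \<open>p\<close> was
      missing from \<open>F'\<close> already.\<close>
    have r: "card (component E (M F') p \<inter> ?F) = r"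
    proof (cases "p = v")
      case True
      have "card (component E (M F') u \<inter> F') = r" by (rule P_maximal_block[OF PF' uP u(3)])
      then show ?thesis using component_eq[OF sym u(1)] card True by simp
    next
      case False
      then show ?thesis using P_maximal_block[OF PF', of p] p card by simp
    qed
    have "M (insert p ?F) = M F'" using M p by (auto simp: M_def)
    moreover have "component E (M F') p \<inter> insert p ?F = insert p (component E (M F') p \<inter> ?F)"
      using component_self by fast
    then have "card (component E (M F') p \<inter> insert p ?F) = Suc r" using r p fin by simp
    ultimately show ?thesis unfolding ok_iff by (metis Suc_n_not_le_n)
  qed
  ultimately have "P_maximal ?F" unfolding P_maximal_def by blast
  moreover have "\<exists>x \<in> ?F \<inter> S. (w, x) \<in> E" if "w \<in> W - ?F" for w
  proof -
    have "w \<in> W - F'" using that v(1) disj by blast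
    then show ?thesis using domF' v(1) disj by blast
  qed
  ultimately have "?F \<in> facets {A. ok A}" unfolding facets_ok_iff by blast
  with u uP that show thesis by blast
qed

text \<open>The facet \<open>F\<close> misses \<open>v\<close>, so \<open>v\<close> has a neighbour
  in \<open>F \<inter> S\<close>, which survives in any set with the same trace on \<open>S\<close>.
  Filling up \<open>F' - {v}\<close> with vertices of \<open>P\<close> therefore already gives a
  facet.\<close>

lemma facet_exchange_W:
  assumes F: "F \<in> facets {A. ok A}" and F': "F' \<in> facets {A. ok A}"
    and v: "v \<in> W" "v \<in> F'" "v \<notin> F" and agree: "F \<inter> S = F' \<inter> S"
  obtains F'' where "F'' \<in> facets {A. ok A}" "F' - {v} \<subseteq> F''" "v \<notin> F''" "F'' - F' \<subseteq> P"
proof -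
  have "ok (F' - {v})" using F' ok_subset[of F'] unfolding facets_def by blast
  then obtain A where A: "P_maximal A" "F' - {v} \<subseteq> A" "A \<subseteq> (F' - {v}) \<union> P"
    by (rule P_maximal_extension)
  have AS: "A \<inter> S = F' \<inter> S" using A v disj by blast
  have "\<exists>x \<in> A \<inter> S. (w, x) \<in> E" if w: "w \<in> W - A" for w
  proof (cases "w = v")
    case True
    then show ?thesis using F v agree AS unfolding facets_ok_iff by blast
  next
    case False
    then show ?thesis using F' w A(2) AS unfolding facets_ok_iff by blast
  qed
  then have "A \<in> facets {A. ok A}" using A(1) unfolding facets_ok_iff by blast
  then show thesis using that A v disj by blast
qed

text \<open>Saturating with \<open>P\<close> first keeps \<open>v\<close> out: by
  \<open>P_maximal_blocked\<close> with \<open>x = y\<close>, no vertex of \<open>S\<close> fits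
  into any later extension.\<close>

lemma facet_exchange_S:
  assumes F': "F' \<in> facets {A. ok A}" and v: "v \<in> S" "v \<in> F'"
  obtains F'' where "F'' \<in> facets {A. ok A}" "F' - {v} \<subseteq> F''" "v \<notin> F''" "F'' - F' \<subseteq> W \<union> P"
proof -
  have "ok (F' - {v})" using F' ok_subset[of F'] unfolding facets_def by blast
  then obtain A where A: "P_maximal A" "F' - {v} \<subseteq> A" "A \<subseteq> (F' - {v}) \<union> P"
    by (rule P_maximal_extension)
  \<comment> \<open>\<open>A\<close> may fail to be a facet, because \<open>v\<close> could have
    been the only chosen neighbour of a vertex of \<open>W\<close>; a maximal extension
    \<open>B\<close> repairs this.\<close>
  have "finite {B. ok B}" by (rule finite_subset[of _ "Pow V"]) (use finite_V in \<open>auto simp: ok_def\<close>)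
  moreover have "ok A" using A(1) unfolding P_maximal_def by blast
  ultimately obtain B where B: "A \<subseteq> B" "ok B" and max: "\<And>C. ok C \<Longrightarrow> B \<subseteq> C \<Longrightarrow> C = B"
    using finite_has_maximal2[of "{B. ok B}" A] by auto
  have new: "y \<notin> S" if y: "y \<in> B" "y \<notin> A" for y
  proof
    assume "y \<in> S"
    moreover have "ok (insert y A)" using ok_subset[OF B(2)] B(1) y(1) by blast
    ultimately show False using P_maximal_blocked[OF A(1) y(2)] by blast
  qed
  have BV: "B \<subseteq> V" using B(2) unfolding ok_def by blast
  show thesis
  proof (rule that)
    show "B \<in> facets {A. ok A}" unfolding facets_def using B max by blast
    show "F' - {v} \<subseteq> B" using A B by blast
    show "v \<notin> B" using new A(3) v disj by blast
    show "B - F' \<subseteq> W \<union> P" using new A(3) BV unfolding V_def by blast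
  qed
qed

lemma shellable_ok: "shellable {A. ok A}"
proof -
  obtain g :: "'a \<Rightarrow> nat" where g: "inj_on g V"
    using finite_imp_inj_to_nat_seg[OF finite_V] by blast
  define n where "n = Suc (Max (g ` V))"
  have gn: "g u < n" if "u \<in> V" for u
    using that finite_V unfolding n_def by (simp add: le_imp_less_Suc)
  \<comment> \<open>Three bands of width \<open>n\<close>, with \<open>P\<close> below
    \<open>W\<close> below \<open>S\<close>, so vertices brought in from a lower class are lighter
    than \<open>v\<close>.\<close>
  define f where "f u = g u + (if u \<in> S then 2 * n else if u \<in> W then n else 0)" for u
  have fP: "f u = g u" if "u \<in> P" for u using that disj by (auto simp: f_def)
  have fW: "f u = g u + n" if "u \<in> W" for u using that disj by (auto simp: f_def)
  have fS: "f u = g u + 2 * n" if "u \<in> S" for u using that by (auto simp: f_def)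
  have PV: "P \<subseteq> V" "W \<subseteq> V" "S \<subseteq> V" by (auto simp: V_def)
  show ?thesis
  proof (rule shellable_lexicographic[OF finite_V])
    show "F \<subseteq> V" if "F \<in> facets {A. ok A}" for F
      using that unfolding facets_def ok_def by blast
    show "inj_on f V"
    proof (rule inj_onI)
      fix a b assume ab: "a \<in> V" "b \<in> V" "f a = f b"
      then have "g a = g b"
        using gn[OF ab(1)] gn[OF ab(2)] by (auto simp: f_def split: if_splits)
      with g ab show "a = b" by (auto dest: inj_onD)
    qed
  next
    fix F F' v
    assume F: "F \<in> facets {A. ok A}" and F': "F' \<in> facets {A. ok A}" and v: "v \<in> F'" "v \<notin> F"
      and agree: "\<And>u. u \<in> V \<Longrightarrow> f u > f v \<Longrightarrow> u \<in> F \<longleftrightarrow> u \<in> F'"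
    have sub: "F \<subseteq> V" "F' \<subseteq> V" using F F' unfolding facets_def ok_def by auto
    have vV: "v \<in> V" using sub v by blast
    then consider "v \<in> S" | "v \<in> W" | "v \<in> P" unfolding V_def by blast
    then show "\<exists>F'' \<in> facets {A. ok A}. F' - {v} \<subseteq> F'' \<and> v \<notin> F'' \<and> (\<forall>u \<in> F'' - F'. f u < f v)"
    proof cases
      case 1
      then obtain F'' where "F'' \<in> facets {A. ok A}" "F' - {v} \<subseteq> F''" "v \<notin> F''" "F'' - F' \<subseteq> W \<union> P"
        using facet_exchange_S[OF F'] v by blast
      moreover have "f u < f v" if "u \<in> W \<union> P" for u
        using that fP[of u] fW[of u] fS[OF 1] gn[of u] PV by fastforce
      ultimately show ?thesis by blast
    next
      case 2
      have "f u > f v" if "u \<in> S" for u using fS[OF that] fW[OF 2] gn[OF vV] by simp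
      then have "F \<inter> S = F' \<inter> S" using agree PV by blast
      then obtain F'' where "F'' \<in> facets {A. ok A}" "F' - {v} \<subseteq> F''" "v \<notin> F''" "F'' - F' \<subseteq> P"
        using facet_exchange_W[OF F F' 2] v by blast
      moreover have "f u < f v" if "u \<in> P" for u
        using fP[OF that] fW[OF 2] gn[of u] PV that by fastforce
      ultimately show ?thesis by blast
    next
      case 3
      have "f u > f v" if "u \<in> S \<union> W" for u
        using that fS[of u] fW[of u] fP[OF 3] gn[OF vV] by fastforce
      then have "F - P = F' - P" using agree sub unfolding V_def by blast
      then obtain u where u: "u \<in> F" "u \<notin> F'" "u \<in> P" "insert u (F' - {v}) \<in> facets {A. ok A}"
        using facet_exchange_P[OF F F' 3] v by blast
      have "f u \<noteq> f v" using fP[OF 3] fP[OF u(3)] g u v PV 3 by (metis inj_onD subsetD)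
      \<comment> \<open>The exchange in \<open>P\<close> does not control the weight of
        \<open>u\<close>; the agreement above \<open>f v\<close> does, since \<open>u\<close> lies
        in \<open>F\<close> but not in \<open>F'\<close>.\<close>
      moreover have "\<not> f u > f v" using agree[of u] u PV by blast
      ultimately have "f u < f v" by simp
      then show ?thesis using u v by (intro bexI[OF _ u(4)]) auto
    qed
  qed
qed

end


section \<open>Star-clique attachments\<close>

text \<open>As the arcs are symmetric, reachability in an induced subgraph is mutual, so its
  strongly connected components are the sets \<open>component (parcs G) A u\<close> with
  \<open>u\<close> in \<open>A\<close>.\<close>

lemma Ind_conv_component:
  assumes G: "pair_graph G"
  shows "Ind r G = {A. A \<subseteq> pverts G \<and> (\<forall>u \<in> A. card (component (parcs G) A u) \<le> r)}"
proof -
  interpret G: pair_graph G by (rule G)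
  have symE: "sym (parcs G)" using pair_graphD(2)[OF G] by (auto intro: symI)
  have "(\<forall>C \<in> pre_digraph.sccs_verts (with_proj G \<restriction> A). card C \<le> r) \<longleftrightarrow>
      (\<forall>u \<in> A. card (component (parcs G) A u) \<le> r)" if A: "A \<subseteq> pverts G" for A
  proof -
    let ?GA = "with_proj G \<restriction> A" and ?R = "parcs G \<inter> A \<times> A"
    interpret GA: wf_digraph ?GA by (rule G.wellformed_induce_subgraph)
    have ends: "arcs_ends ?GA = ?R" by (auto simp: arcs_ends_conv)
    have reach: "u \<rightarrow>\<^sup>*\<^bsub>?GA\<^esub> v \<longleftrightarrow> u \<in> A \<and> v \<in> component (parcs G) A u" for u v
    proof
      assume "u \<rightarrow>\<^sup>*\<^bsub>?GA\<^esub> v"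
      then show "u \<in> A \<and> v \<in> component (parcs G) A u"
        unfolding reachable_def component_def ends using rtrancl_on_rtranclI[of u v A ?R]
        by (auto dest: in_rtrancl_on_in_F)
    next
      assume "u \<in> A \<and> v \<in> component (parcs G) A u"
      then have u: "u \<in> A" and "(u, v) \<in> ?R\<^sup>*" by (auto simp: component_def)
      from this(2) show "u \<rightarrow>\<^sup>*\<^bsub>?GA\<^esub> v"
        unfolding reachable_def ends
        by induction (use u in \<open>auto intro: rtrancl_on_into_rtrancl_on\<close>)
    qed
    have mem: "C \<in> pre_digraph.sccs_verts ?GA \<longleftrightarrow> (\<exists>u \<in> A. C = component (parcs G) A u)" for C
    proof
      assume C: "C \<in> pre_digraph.sccs_verts ?GA"
      then obtain u where u: "u \<in> C" unfolding pre_digraph.sccs_verts_def by blast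
      with C have uA: "u \<in> A" unfolding pre_digraph.sccs_verts_def reach by blast
      have "v \<in> C" if v: "v \<in> component (parcs G) A u" for v
      proof -
        have "u \<in> component (parcs G) A v" using component_eq[OF symE v] component_self by metis
        moreover have "v \<in> A" using v component_subset[OF uA] by blast
        ultimately show ?thesis
          using C u uA v unfolding pre_digraph.sccs_verts_def reach by blast
      qed
      moreover have "C \<subseteq> component (parcs G) A u"
        using C u unfolding pre_digraph.sccs_verts_def reach by blast
      ultimately show "\<exists>u \<in> A. C = component (parcs G) A u" using uA by blast
    next
      assume "\<exists>u \<in> A. C = component (parcs G) A u"
      then obtain u where u: "u \<in> A" "C = component (parcs G) A u" by blast
      have eq: "component (parcs G) A a = C" if "a \<in> C" for a
        using component_eq[OF symE] that u(2) by metis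
      have "C \<noteq> {}" "C \<subseteq> A" using component_self component_subset[OF u(1)] u(2) by fast+
      with eq show "C \<in> pre_digraph.sccs_verts ?GA"
        unfolding pre_digraph.sccs_verts_def reach by auto
    qed
    show ?thesis
      unfolding Ball_def mem by blast
  qed
  then show ?thesis unfolding Ind_def r_independent_def by blast
qed

text \<open>The cliques meet pairwise in \<open>x\<close> alone, so \<open>p\<close> lies in exactly
  one of them, and all its neighbours lie there too.\<close>

lemma star_clique_simplicial:
  assumes "star_clique x C" "p \<in> pverts C" "p \<noteq> x"
  shows "(p, x) \<in> parcs C" and "simplicial (parcs C) p"
proof -
  obtain Bs where B: "\<And>B. B \<in> Bs \<Longrightarrow> x \<in> pverts B \<and> complete_digraph (card (pverts B)) (with_proj B)"
    and pw: "pairwise (\<lambda>B B'. pverts B \<inter> pverts B' = {x}) Bs"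
    and C: "C = \<lparr> pverts = insert x (\<Union>B \<in> Bs. pverts B), parcs = (\<Union>B \<in> Bs. parcs B) \<rparr>"
    using assms(1) unfolding star_clique_def by blast
  have arcs: "parcs B = {(u, v). u \<in> pverts B \<and> v \<in> pverts B \<and> u \<noteq> v}" if "B \<in> Bs" for B
    using B[OF that] by (auto simp: complete_digraph_pair_def)
  obtain B where p: "B \<in> Bs" "p \<in> pverts B" using assms by (auto simp: C)
  have uniq: "B' = B" if "B' \<in> Bs" "p \<in> pverts B'" for B'
    using pairwiseD[OF pw p(1) that(1)] that p assms(3) by blast
  show "(p, x) \<in> parcs C" using p B arcs assms(3) by (auto simp: C)
  have "a \<in> pverts B \<and> b \<in> pverts B" if "(p, a) \<in> parcs C" "(p, b) \<in> parcs C" for a b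
    using that uniq arcs by (auto simp: C)
  then show "simplicial (parcs C) p"
    unfolding simplicial_def using arcs[OF p(1)] p(1) by (auto simp: C)
qed

theorem theorem5p1:
  fixes r :: nat and H G :: "'a pair_pre_digraph" and S :: "'a set"
  assumes "r \<ge> 1"
    and "pair_graph H"
    and "vertex_cover H S"
    and "is_CCG H S r G"
  shows "shellable (Ind r G)"
proof -
  have S: "S \<subseteq> pverts H" and cover: "\<And>u v. (u, v) \<in> parcs H \<Longrightarrow> u \<in> S \<or> v \<in> S"
    using assms(3) unfolding vertex_cover_def by auto
  obtain SC where CCG: "\<forall>x \<in> S. star_clique x (SC x) \<and> card (pverts (SC x)) \<ge> r + 1 \<and>
        (pverts (SC x) - {x}) \<inter> pverts H = {}"
      "\<forall>x \<in> S. \<forall>y \<in> S. x \<noteq> y \<longrightarrow> (pverts (SC x) - {x}) \<inter> (pverts (SC y) - {y}) = {}"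
    and G: "G = \<lparr> pverts = pverts H \<union> (\<Union>x \<in> S. pverts (SC x)),
            parcs = parcs H \<union> (\<Union>x \<in> S. parcs (SC x)) \<rparr>"
    using assms(4) unfolding is_CCG_def by (elim exE conjE)
  have SC: "star_clique x (SC x)" and cardSC: "card (pverts (SC x)) \<ge> r + 1"
    and new: "(pverts (SC x) - {x}) \<inter> pverts H = {}" if "x \<in> S" for x
    using CCG(1) that by auto
  have disj: "(pverts (SC x) - {x}) \<inter> (pverts (SC y) - {y}) = {}"
    if "x \<in> S" "y \<in> S" "x \<noteq> y" for x y
    using CCG(2) that by blast
  note pgG = is_CCG_pair_graph[OF assms(2) S assms(4)]
  note GD = pair_graphD[OF pgG] and HD = pair_graphD[OF assms(2)]
  have SCD: "u \<in> pverts (SC x) \<and> v \<in> pverts (SC x)" if "x \<in> S" "(u, v) \<in> parcs (SC x)" for x u v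
    using pair_graphD(2)[OF star_clique_pair_graph[OF SC[OF that(1)]] that(2)] by blast
  define W where "W = pverts H - S"
  define P where "P = pverts G - pverts H"
  have P: "\<exists>x \<in> S. p \<in> pverts (SC x) \<and> p \<noteq> x" if "p \<in> P" for p
    using that S unfolding P_def G by auto
  have V: "pverts G = S \<union> W \<union> P"
    using S unfolding W_def P_def G by auto
  have notH: "p \<notin> pverts H" if "x \<in> S" "p \<in> pverts (SC x)" "p \<noteq> x" for x p
    using new[OF that(1)] that by blast
  \<comment> \<open>An attached vertex is not in \<open>H\<close>, and distinct star-cliques share
    no new vertices, so its arcs stay in its own star-clique. This carries \<open>simplicial\<close>
    from \<open>SC x\<close> over to \<open>G\<close>.\<close>
  have nbrP: "(p, a) \<in> parcs (SC x)" if x: "x \<in> S" "p \<in> pverts (SC x)" "p \<noteq> x" and a: "(p, a) \<in> parcs G"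
    for p x a
  proof -
    have "(p, a) \<notin> parcs H" using HD(2) notH[OF x] by blast
    with a obtain y where y: "y \<in> S" "(p, a) \<in> parcs (SC y)" unfolding G by auto
    then have p: "p \<in> pverts (SC y)" using SCD by blast
    moreover have "p \<noteq> y" using notH[OF x] y(1) S by blast
    ultimately have "y = x" using disj[OF x(1) y(1)] x by blast
    with y show ?thesis by simp
  qed
  interpret simplicial_cover r "parcs G" S W P
  proof
    show "r \<ge> 1" by (rule assms(1))
    show "finite S" "finite W" "finite P"
      using finite_subset[OF S HD(1)] HD(1) GD(1) unfolding W_def P_def by auto
    show "S \<inter> W = {}" "S \<inter> P = {}" "W \<inter> P = {}"
      using S unfolding W_def P_def by auto
    show "sym (parcs G)" using GD(2) by (auto intro: symI)
  next
    fix p assume "p \<in> P"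
    then obtain x where x: "x \<in> S" "p \<in> pverts (SC x)" "p \<noteq> x" using P by blast
    have "parcs (SC x) \<subseteq> parcs G" using x(1) unfolding G by auto
    with star_clique_simplicial(2)[OF SC[OF x(1)] x(2,3)] nbrP[OF x]
    show "simplicial (parcs G) p" unfolding simplicial_def by blast
  next
    fix x assume x: "x \<in> S"
    have "finite (pverts (SC x))" using pair_graphD(1)[OF star_clique_pair_graph[OF SC[OF x]]] .
    \<comment> \<open>Removing the centre costs one of the at least \<open>r + 1\<close>
      vertices.\<close>
    then have "r \<le> card (pverts (SC x) - {x})"
      using cardSC[OF x] by (cases "x \<in> pverts (SC x)") (auto simp: card_Diff_singleton)
    also have "\<dots> \<le> card {p \<in> P. (x, p) \<in> parcs G}"
    proof (rule card_mono)
      show "finite {p \<in> P. (x, p) \<in> parcs G}" using GD(1) unfolding P_def by simp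
      show "pverts (SC x) - {x} \<subseteq> {p \<in> P. (x, p) \<in> parcs G}"
      proof
        fix p assume p: "p \<in> pverts (SC x) - {x}"
        then have "(p, x) \<in> parcs G"
          using star_clique_simplicial(1)[OF SC[OF x]] x unfolding G by auto
        then have "(x, p) \<in> parcs G" "p \<in> pverts G" using GD(2) by blast+
        then show "p \<in> {p \<in> P. (x, p) \<in> parcs G}" using notH[OF x] p unfolding P_def by blast
      qed
    qed
    finally show "r \<le> card {p \<in> P. (x, p) \<in> parcs G}" .
  next
    fix w y assume w: "w \<in> W" and wy: "(w, y) \<in> parcs G"
    \<comment> \<open>A vertex of \<open>W\<close> is in \<open>H\<close> but is no centre, so it
      lies in no star-clique and all its arcs come from \<open>H\<close>.\<close>
    have "(w, y) \<notin> parcs (SC x)" if x: "x \<in> S" for x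
      using SCD[OF x, of w y] notH[OF x, of w] w x unfolding W_def by blast
    then have "(w, y) \<in> parcs H" using wy unfolding G by auto
    then show "y \<in> S" using cover w unfolding W_def by blast
  qed
  have "Ind r G = {A. ok A}"
    unfolding Ind_conv_component[OF pgG] ok_def V_def V ..
  then show ?thesis using shellable_ok by simp
qed

end
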